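(* Let $X$ and $Y$ be real normed spaces of dimension at least $2$, let $\lambda\in[0,1]$, and let $T:X\to Y$ be a nonzero bounded linear mapping. Then the following conditions are equivalent: (i) $T$ preserves $\rho_{\lambda}$-orthogonality, i.e. for all $x,y\in X$, $x\perp_{\rho_\lambda}y$ implies $Tx\perp_{\rho_\lambda}Ty$. (ii) $\|Tx\| = \|T\|\,\|x\|$ for all $x\in X$. (iii) $\rho_{\lambda}(Tx, Ty) = \|T\|^2\,\rho_{\lambda}(x, y)$ for all $x, y\in X$.
   Context: For a real normed space $Z$ and $x,y\in Z$, the norm derivatives are $\rho_{-}(x,y):=\|x\|\lim_{t\to 0^{-}}\frac{\|x+ty\|-\|x\|}{t}$ and $\rho_{+}(x,y):=\|x\|\lim_{t\to 0^{+}}\frac{\|x+ty\|-\|x\|}{t}$ (the limits exist by convexity of the norm). For $\lambda\in[0,1]$, $\rho_{\lambda}(x, y) := \lambda\rho_-(x,y) + (1 - \lambda)\rho_+(x,y)$, and $x\perp_{\rho_{\lambda}}y$ means $\rho_{\lambda}(x,y)=0$. The same notation is used in $X$ and in $Y$, each with its own norm; $\|T\|$ is the operator norm of $T$. *)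

theory Defs
  imports "HOL-Analysis.Analysis"
begin

text \<open>Both one-sided limits exist because the difference quotient is monotone in \<open>t\<close> (the norm is
  convex) and bounded by \<open>norm y\<close>, so \<open>Lim\<close> never takes its unspecified value here.\<close>

definition rho_minus :: "'a::real_normed_vector \<Rightarrow> 'a \<Rightarrow> real" where
  "rho_minus x y = norm x * Lim (at_left 0) (\<lambda>t. (norm (x + t *\<^sub>R y) - norm x) / t)"

definition rho_plus :: "'a::real_normed_vector \<Rightarrow> 'a \<Rightarrow> real" where
  "rho_plus x y = norm x * Lim (at_right 0) (\<lambda>t. (norm (x + t *\<^sub>R y) - norm x) / t)"

definition rho :: "real \<Rightarrow> 'a::real_normed_vector \<Rightarrow> 'a \<Rightarrow> real" where
  "rho lam x y = lam * rho_minus x y + (1 - lam) * rho_plus x y"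

definition rho_orthogonal :: "real \<Rightarrow> 'a::real_normed_vector \<Rightarrow> 'a \<Rightarrow> bool" where
  "rho_orthogonal lam x y \<longleftrightarrow> rho lam x y = 0"

end

theory Submission
  imports Defs
begin

text \<open>
  Why the theorem holds.  Only the passage from preservation of orthogonality to a multiple of an
  isometry has content; the other implications come from the scaling of difference quotients and
  from \<open>rho lam x x = (norm x)\<^sup>2\<close>.

  Subtracting the multiple \<open>rho lam x y / (norm x)\<^sup>2\<close> of \<open>x\<close> from \<open>y\<close> yields a vector orthogonal to
  \<open>x\<close>.  Since \<open>T\<close> preserves this relation, one gets the proportionality
  \<open>rho lam (T x) (T y) * (norm x)\<^sup>2 = (norm (T x))\<^sup>2 * rho lam x y\<close>
  (\<open>preserves_imp_proportional\<close>).  It forces \<open>T\<close> to be injective: near a nonzero kernel vector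
  the logarithmic derivative of the image norm would blow up, while that of the original norm
  stays bounded (\<open>proportional_imp_injective\<close>).

  It remains to see that the ratio \<open>norm (T x) / norm x\<close> is the same at all nonzero points.  Along a
  line \<open>x + t v\<close> that avoids the origin, the proportionality says that \<open>p t = norm (x + t v)\<close> and
  \<open>q t = norm (T (x + t v))\<close> have equal weighted logarithmic derivatives.  Instead of differentiating
  the logarithm of \<open>q / p\<close>, which fails at the kinks of the norms, the proof uses that the weighted
  one-sided derivative \<open>D\<close> of \<open>p\<close> is a subgradient of \<open>p\<close>, and that \<open>(q / p) D\<close> is a subgradient of
  \<open>q\<close>.  Together these give
  \<open>\<bar>(q / p) s - (q / p) t\<bar> \<le> C * ((D s - D t) * (s - t))\<close>,
  where \<open>D\<close> is nondecreasing.  Summing over a subdivision into \<open>n\<close> equal parts bounds the total change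
  of \<open>q / p\<close> by \<open>C * (D 1 - D 0) / n\<close>, so \<open>q / p\<close> is constant.
\<close>

section \<open>One-sided derivatives of the norm\<close>

text \<open>The point \<open>x + s y\<close> is a convex combination of \<open>x\<close> and \<open>x + t y\<close>, and the norm is convex.\<close>

lemma norm_diff_quotient_mono:
  fixes x y :: "'a::real_normed_vector"
  assumes "0 < s" "s \<le> t"
  shows "(norm (x + s *\<^sub>R y) - norm x) / s \<le> (norm (x + t *\<^sub>R y) - norm x) / t"
proof -
  have t: "0 < t" using assms by linarith
  have "t *\<^sub>R (x + s *\<^sub>R y) = (t - s) *\<^sub>R x + s *\<^sub>R (x + t *\<^sub>R y)"
    by (simp add: algebra_simps)
  then have "norm (t *\<^sub>R (x + s *\<^sub>R y)) \<le> norm ((t - s) *\<^sub>R x) + norm (s *\<^sub>R (x + t *\<^sub>R y))"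
    by (metis norm_triangle_ineq)
  then have "t * norm (x + s *\<^sub>R y) \<le> (t - s) * norm x + s * norm (x + t *\<^sub>R y)"
    using assms t by simp
  then show ?thesis using assms t by (simp add: field_simps)
qed

lemma norm_diff_quotient_bound:
  fixes x y :: "'a::real_normed_vector"
  assumes "0 < t"
  shows "\<bar>(norm (x + t *\<^sub>R y) - norm x) / t\<bar> \<le> norm y"
proof -
  have "\<bar>norm (x + t *\<^sub>R y) - norm x\<bar> \<le> t * norm y"
    using norm_triangle_ineq3[of "x + t *\<^sub>R y" x] assms by simp
  then show ?thesis using assms by (simp add: abs_divide field_simps)
qed

lemma rho_plus_tendsto:
  fixes x y :: "'a::real_normed_vector"
  shows "((\<lambda>t. norm x * ((norm (x + t *\<^sub>R y) - norm x) / t)) \<longlongrightarrow> rho_plus x y) (at_right 0)"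
proof -
  let ?f = "\<lambda>t. (norm (x + t *\<^sub>R y) - norm x) / t"
  have "(?f \<longlongrightarrow> Inf (?f ` ({0<..} \<inter> UNIV))) (at 0 within ({0<..} \<inter> UNIV))"
  proof (rule Lim_right_bound)
    show "?f a \<le> ?f b" if "0 < a" "a \<le> b" for a b
      using norm_diff_quotient_mono that .
    show "- norm y \<le> ?f a" if "0 < a" for a
      using norm_diff_quotient_bound[OF that, of x y] by linarith
  qed
  then have "(?f \<longlongrightarrow> Inf (?f ` {0<..})) (at_right 0)" by simp
  moreover from this have "Lim (at_right 0) ?f = Inf (?f ` {0<..})"
    by (intro tendsto_Lim) auto
  ultimately have "(?f \<longlongrightarrow> Lim (at_right 0) ?f) (at_right 0)" by simp
  then show ?thesis unfolding rho_plus_def by (intro tendsto_mult_left)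
qed

lemma rho_plus_eqI:
  assumes "((\<lambda>t. norm x * ((norm (x + t *\<^sub>R y) - norm x) / t)) \<longlongrightarrow> l) (at_right 0)"
  shows "rho_plus x y = l"
  using tendsto_unique[OF _ rho_plus_tendsto assms] by simp

lemma rho_minus_eq: "rho_minus x y = - rho_plus x (- y)"
proof (cases "x = 0")
  case False
  let ?g = "\<lambda>t. (norm (x + t *\<^sub>R (- y)) - norm x) / t"
  have "((\<lambda>t. norm x * ?g t / norm x) \<longlongrightarrow> rho_plus x (- y) / norm x) (at_right 0)"
    using False by (intro tendsto_divide rho_plus_tendsto) auto
  then have "((\<lambda>t. - ?g t) \<longlongrightarrow> - (rho_plus x (- y) / norm x)) (at_right 0)"
    using False by (intro tendsto_minus) simp
  then have "((\<lambda>t. (norm (x + t *\<^sub>R y) - norm x) / t) \<longlongrightarrow> - (rho_plus x (- y) / norm x)) (at_left 0)"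
    by (simp add: filterlim_at_left_to_right)
  then have "Lim (at_left 0) (\<lambda>t. (norm (x + t *\<^sub>R y) - norm x) / t) = - (rho_plus x (- y) / norm x)"
    by (intro tendsto_Lim) auto
  then show ?thesis using False by (simp add: rho_minus_def)
qed (simp add: rho_minus_def rho_plus_def)

lemma rho_plus_le:
  assumes "0 < t"
  shows "t * rho_plus x y \<le> norm x * (norm (x + t *\<^sub>R y) - norm x)"
proof -
  have "\<forall>\<^sub>F s in at_right 0. norm x * ((norm (x + s *\<^sub>R y) - norm x) / s)
          \<le> norm x * ((norm (x + t *\<^sub>R y) - norm x) / t)"
    using eventually_at_right_less[of "0::real"] eventually_at_right_real[OF assms]
    by eventually_elim (intro mult_left_mono norm_diff_quotient_mono, auto)
  then have "rho_plus x y \<le> norm x * ((norm (x + t *\<^sub>R y) - norm x) / t)"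
    by (intro tendsto_upperbound[OF rho_plus_tendsto]) auto
  then show ?thesis using assms by (simp add: field_simps)
qed

lemma rho_minus_le_rho_plus: "rho_minus x y \<le> rho_plus x y"
proof -
  let ?f = "\<lambda>y t. norm x * ((norm (x + t *\<^sub>R y) - norm x) / t)"
  have lim: "((\<lambda>t. ?f y t + ?f (- y) t) \<longlongrightarrow> rho_plus x y + rho_plus x (- y)) (at_right 0)"
    by (intro tendsto_add rho_plus_tendsto)
  have "0 \<le> ?f y t + ?f (- y) t" if "0 < t" for t
  proof -
    have "norm ((x + t *\<^sub>R y) + (x - t *\<^sub>R y)) \<le> norm (x + t *\<^sub>R y) + norm (x - t *\<^sub>R y)"
      by (rule norm_triangle_ineq)
    then have "2 * norm x \<le> norm (x + t *\<^sub>R y) + norm (x - t *\<^sub>R y)"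
      by (simp flip: scaleR_2)
    then have "0 \<le> norm x * ((norm (x + t *\<^sub>R y) + norm (x - t *\<^sub>R y) - 2 * norm x) / t)"
      using that by simp
    also have "\<dots> = ?f y t + ?f (- y) t"
      using that by (simp add: field_simps)
    finally show ?thesis .
  qed
  then have "\<forall>\<^sub>F t in at_right 0. 0 \<le> ?f y t + ?f (- y) t"
    using eventually_at_right_less[of "0::real"] by (auto elim: eventually_mono)
  then have "0 \<le> rho_plus x y + rho_plus x (- y)"
    by (intro tendsto_lowerbound[OF lim]) auto
  then show ?thesis by (simp add: rho_minus_eq)
qed

text \<open>Up to an error of order \<open>t\<^sup>2\<close>, the vector \<open>x + t (a x + y)\<close> is \<open>(1 + t a) (x + t y)\<close>, whose norm
  is an explicit multiple of \<open>norm (x + t y)\<close> for small \<open>t\<close>.\<close>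

lemma rho_plus_add_multiple:
  fixes x y :: "'a::real_normed_vector"
  shows "rho_plus x (a *\<^sub>R x + y) = a * (norm x)\<^sup>2 + rho_plus x y"
proof (rule rho_plus_eqI)
  let ?g = "\<lambda>t. norm x * ((norm (x + t *\<^sub>R (a *\<^sub>R x + y)) - norm x) / t)"
  let ?h = "\<lambda>t. norm x * (a * norm (x + t *\<^sub>R y)) + norm x * ((norm (x + t *\<^sub>R y) - norm x) / t)"
  have "((\<lambda>t. norm x * (a * norm (x + t *\<^sub>R y))) \<longlongrightarrow> norm x * (a * norm (x + 0 *\<^sub>R y))) (at_right 0)"
    by (intro tendsto_intros)
  then have h: "(?h \<longlongrightarrow> a * (norm x)\<^sup>2 + rho_plus x y) (at_right 0)"
    by (intro tendsto_add rho_plus_tendsto) (simp add: power2_eq_square mult.left_commute)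
  have e: "((\<lambda>t. norm x * (t * (\<bar>a\<bar> * norm y))) \<longlongrightarrow> 0) (at_right 0)"
    by (auto intro!: tendsto_eq_intros)
  have small: "\<forall>\<^sub>F t in at_right 0. 0 < t \<and> 0 < 1 + t * a"
  proof -
    have "((\<lambda>t. 1 + t * a) \<longlongrightarrow> 1 + 0 * a) (at_right 0)"
      by (intro tendsto_intros)
    then have "\<forall>\<^sub>F t in at_right 0. 0 < 1 + t * a"
      by (intro order_tendstoD(1)) auto
    then show ?thesis
      using eventually_at_right_less[of "0::real"] by eventually_elim auto
  qed
  have "\<forall>\<^sub>F t in at_right 0. norm (?g t - ?h t) \<le> norm x * (t * (\<bar>a\<bar> * norm y))"
    using small
  proof eventually_elim
    case (elim t)
    let ?u = "x + t *\<^sub>R (a *\<^sub>R x + y)" and ?w = "x + t *\<^sub>R y"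
    have "?u - (1 + t * a) *\<^sub>R ?w = - ((t * a * t) *\<^sub>R y)"
      by (simp add: algebra_simps)
    then have "norm (?u - (1 + t * a) *\<^sub>R ?w) = t * (t * (\<bar>a\<bar> * norm y))"
      using elim by (simp add: abs_mult)
    then have "\<bar>norm ?u - (1 + t * a) * norm ?w\<bar> \<le> t * (t * (\<bar>a\<bar> * norm y))"
      using norm_triangle_ineq3[of ?u "(1 + t * a) *\<^sub>R ?w"] elim by simp
    then have "\<bar>norm ?u - (1 + t * a) * norm ?w\<bar> / t \<le> t * (\<bar>a\<bar> * norm y)"
      using elim by (simp add: field_simps)
    then have "norm x * (\<bar>norm ?u - (1 + t * a) * norm ?w\<bar> / t) \<le> norm x * (t * (\<bar>a\<bar> * norm y))"
      by (intro mult_left_mono) auto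
    moreover have "?g t - ?h t = norm x * ((norm ?u - (1 + t * a) * norm ?w) / t)"
      using elim by (simp add: field_simps)
    ultimately show ?case using elim by (simp add: abs_mult)
  qed
  then have "((\<lambda>t. ?g t - ?h t) \<longlongrightarrow> 0) (at_right 0)"
    by (rule Lim_null_comparison[OF _ e])
  from tendsto_add[OF this h]
  show "(?g \<longlongrightarrow> a * (norm x)\<^sup>2 + rho_plus x y) (at_right 0)" by simp
qed

section \<open>The weighted norm derivative\<close>

lemma rho_zero_left [simp]: "rho lam 0 y = 0"
  by (simp add: rho_def rho_minus_def rho_plus_def)

lemma rho_add_multiple:
  "rho lam x (a *\<^sub>R x + y) = a * (norm x)\<^sup>2 + rho lam x y"
proof -
  have "rho_minus x (a *\<^sub>R x + y) = a * (norm x)\<^sup>2 + rho_minus x y"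
    using rho_plus_add_multiple[of x "- a" "- y"] by (simp add: rho_minus_eq)
  then show ?thesis
    by (simp only: rho_def rho_plus_add_multiple) (simp add: ring_distribs)
qed

lemma rho_multiple_self: "rho lam x (a *\<^sub>R x) = a * (norm x)\<^sup>2"
proof -
  have "rho_plus x 0 = 0" by (simp add: rho_plus_eqI)
  then have "rho lam x 0 = 0" by (simp add: rho_def rho_minus_eq)
  then show ?thesis using rho_add_multiple[of lam x a 0] by simp
qed

lemma rho_self: "rho lam x x = (norm x)\<^sup>2"
  using rho_multiple_self[of lam x 1] by simp

text \<open>Any weight in the unit interval places \<open>rho lam x y / norm x\<close> between the left and the right
  derivative of \<open>norm (x + t y)\<close> at \<open>0\<close>, hence among the slopes of supporting lines of this convex
  function.\<close>

lemma rho_subgradient: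
  assumes "0 \<le> lam" "lam \<le> 1"
  shows "t * rho lam x y \<le> norm x * (norm (x + t *\<^sub>R y) - norm x)"
proof -
  have upper: "rho lam x y \<le> rho_plus x y"
    using mult_left_mono[OF rho_minus_le_rho_plus[of x y] assms(1)]
    by (simp add: rho_def algebra_simps)
  have lower: "rho_minus x y \<le> rho lam x y"
    using mult_left_mono[OF rho_minus_le_rho_plus[of x y], of "1 - lam"] assms
    by (simp add: rho_def algebra_simps)
  consider "t = 0" | "0 < t" | "t < 0" by linarith
  then show ?thesis
  proof cases
    case 2
    then have "t * rho lam x y \<le> t * rho_plus x y" using upper by simp
    then show ?thesis using rho_plus_le[OF 2, of x y] by linarith
  next
    case 3
    then have "t * rho lam x y \<le> t * rho_minus x y" using lower by simp
    then show ?thesis using rho_plus_le[of "- t" x "- y"] 3 by (simp add: rho_minus_eq)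
  qed simp
qed

lemma rho_le_norm_mult:
  assumes "0 \<le> lam" "lam \<le> 1"
  shows "rho lam x y \<le> norm x * norm y"
proof -
  have "rho lam x y \<le> norm x * (norm (x + y) - norm x)"
    using rho_subgradient[OF assms, of 1 x y] by simp
  also have "\<dots> \<le> norm x * norm y"
    using norm_triangle_ineq[of x y] by (intro mult_left_mono) auto
  finally show ?thesis .
qed

lemma rho_scaled_isometry:
  assumes T: "linear T" and iso: "\<And>x. norm (T x) = c * norm x"
  shows "rho lam (T x) (T y) = c\<^sup>2 * rho lam x y"
proof -
  have plus: "rho_plus (T x) (T y) = c\<^sup>2 * rho_plus x y" for y
  proof (rule rho_plus_eqI)
    have "norm (T x + t *\<^sub>R T y) = c * norm (x + t *\<^sub>R y)" for t
      using iso[of "x + t *\<^sub>R y"] by (simp add: linear_add[OF T] linear_scale[OF T])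
    then have "norm (T x) * ((norm (T x + t *\<^sub>R T y) - norm (T x)) / t)
        = c\<^sup>2 * (norm x * ((norm (x + t *\<^sub>R y) - norm x) / t))" for t
      by (simp add: iso power2_eq_square algebra_simps diff_divide_distrib)
    then show "((\<lambda>t. norm (T x) * ((norm (T x + t *\<^sub>R T y) - norm (T x)) / t))
        \<longlongrightarrow> c\<^sup>2 * rho_plus x y) (at_right 0)"
      by (simp only: tendsto_mult_left[OF rho_plus_tendsto])
  qed
  have "rho_minus (T x) (T y) = c\<^sup>2 * rho_minus x y"
    using plus[of "- y"] by (simp add: rho_minus_eq linear_neg[OF T])
  then show ?thesis using plus[of y] by (simp add: rho_def algebra_simps)
qed

section \<open>A criterion for equal end values\<close>

text \<open>Over a subdivision into \<open>n\<close> equal parts the increments of \<open>D\<close> telescope, while the step length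
  contributes a factor \<open>1 / n\<close>.  This works although \<open>D\<close> may jump, as the derivative of a convex
  function does at kinks.\<close>

lemma endpoints_eq_of_increment_bound:
  fixes f D :: "real \<Rightarrow> real"
  assumes bound: "\<And>s t. 0 \<le> t \<Longrightarrow> t \<le> s \<Longrightarrow> s \<le> 1 \<Longrightarrow> \<bar>f s - f t\<bar> \<le> C * ((D s - D t) * (s - t))"
  shows "f 1 = f 0"
proof -
  have le: "\<bar>f 1 - f 0\<bar> \<le> C * (D 1 - D 0) / real n" if n: "0 < n" for n :: nat
  proof -
    let ?a = "\<lambda>i::nat. real i / real n"
    have "f 1 - f 0 = (\<Sum>i<n. f (?a (Suc i)) - f (?a i))"
      using n sum_lessThan_telescope[of "\<lambda>i. f (?a i)" n] by simp
    also have "\<bar>\<dots>\<bar> \<le> (\<Sum>i<n. \<bar>f (?a (Suc i)) - f (?a i)\<bar>)"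
      by (rule sum_abs)
    also have "\<dots> \<le> (\<Sum>i<n. C / real n * (D (?a (Suc i)) - D (?a i)))"
    proof (rule sum_mono)
      fix i assume "i \<in> {..<n}"
      then have "\<bar>f (?a (Suc i)) - f (?a i)\<bar>
          \<le> C * ((D (?a (Suc i)) - D (?a i)) * (?a (Suc i) - ?a i))"
        by (intro bound) (auto simp: field_simps)
      moreover have "?a (Suc i) - ?a i = 1 / real n"
        by (simp add: diff_divide_distrib[symmetric])
      ultimately show "\<bar>f (?a (Suc i)) - f (?a i)\<bar> \<le> C / real n * (D (?a (Suc i)) - D (?a i))"
        by simp
    qed
    also have "\<dots> = C / real n * (D 1 - D 0)"
      using n sum_lessThan_telescope[of "\<lambda>i. D (?a i)" n]
      by (simp only: sum_distrib_left[symmetric]) simp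
    finally show ?thesis by simp
  qed
  have "(\<lambda>n. C * (D 1 - D 0) / real n) \<longlonglongrightarrow> 0"
    by (rule lim_const_over_n)
  then have "\<bar>f 1 - f 0\<bar> \<le> 0"
    by (rule tendsto_lowerbound) (use le in \<open>auto intro!: eventually_sequentiallyI[of 1]\<close>)
  then show ?thesis by simp
qed

text \<open>The functions \<open>p\<close> and \<open>q\<close> have the same logarithmic subgradient \<open>D / p\<close>.  Estimating \<open>q s\<close> from
  below by the supporting line at \<open>t\<close> and \<open>p s\<close> from above by the slope at \<open>s\<close> leaves only the
  discrepancy \<open>(D s - D t) * (s - t)\<close>, which is symmetric in \<open>s\<close> and \<open>t\<close>.\<close>

lemma ratio_eq_of_common_log_subgradient:
  fixes p q D :: "real \<Rightarrow> real"
  assumes m: "0 < m" "\<And>t. t \<in> {0..1} \<Longrightarrow> m \<le> p t"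
    and q: "\<And>t. t \<in> {0..1} \<Longrightarrow> 0 \<le> q t" "\<And>t. t \<in> {0..1} \<Longrightarrow> q t \<le> K * p t"
    and sub_p: "\<And>s t. s \<in> {0..1} \<Longrightarrow> t \<in> {0..1} \<Longrightarrow> p t + (s - t) * D t \<le> p s"
    and sub_q: "\<And>s t. s \<in> {0..1} \<Longrightarrow> t \<in> {0..1} \<Longrightarrow> q t + (s - t) * (q t / p t * D t) \<le> q s"
  shows "q 1 / p 1 = q 0 / p 0"
proof -
  have one_sided: "q t / p t - q s / p s \<le> (K / m) * ((D s - D t) * (s - t))"
    if st: "s \<in> {0..1}" "t \<in> {0..1}" for s t
  proof -
    have pos: "0 < p t" "0 < p s" using m st by force+
    define E where "E = (D s - D t) * (s - t)"
    have E: "0 \<le> E"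
      using sub_p[OF st] sub_p[OF st(2,1)] by (simp add: E_def algebra_simps)
    have R: "0 \<le> q t / p t" "q t / p t \<le> K"
      using q st(2) pos by (auto simp: field_simps)
    have "p s - E \<le> p t + (s - t) * D t"
      using sub_p[OF st(2,1)] by (simp add: E_def algebra_simps)
    then have "q t / p t * (p s - E) \<le> q t / p t * (p t + (s - t) * D t)"
      by (rule mult_left_mono) (rule R)
    also have "\<dots> = q t + (s - t) * (q t / p t * D t)"
      using pos by (simp add: field_simps)
    also have "\<dots> \<le> q s" by (rule sub_q[OF st])
    finally have "q t / p t * p s - q s \<le> q t / p t * E" by (simp add: right_diff_distrib del: times_divide_eq_left)
    then have "(q t / p t * p s - q s) / p s \<le> (q t / p t * E) / p s"
      using pos by (intro divide_right_mono) auto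
    then have "q t / p t - q s / p s \<le> (q t / p t * E) / p s"
      using pos by (simp add: diff_divide_distrib)
    also have "\<dots> \<le> (K * E) / m"
      using R E m st by (intro frac_le mult_right_mono mult_nonneg_nonneg) auto
    finally show ?thesis by (simp add: E_def)
  qed
  show ?thesis
  proof (rule endpoints_eq_of_increment_bound)
    fix s t :: real assume "0 \<le> t" "t \<le> s" "s \<le> 1"
    then show "\<bar>q s / p s - q t / p t\<bar> \<le> K / m * ((D s - D t) * (s - t))"
      using one_sided[of s t] one_sided[of t s] by (simp add: abs_le_iff algebra_simps)
  qed
qed

section \<open>Maps preserving orthogonality\<close>

lemma preserves_imp_proportional:
  assumes T: "linear T"
    and pres: "\<And>x y. rho_orthogonal lam x y \<Longrightarrow> rho_orthogonal lam (T x) (T y)"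
  shows "rho lam (T x) (T y) * (norm x)\<^sup>2 = (norm (T x))\<^sup>2 * rho lam x y"
proof (cases "x = 0")
  case True
  then show ?thesis by (simp add: linear_0[OF T])
next
  case False
  define a where "a = - (rho lam x y / (norm x)\<^sup>2)"
  have "rho_orthogonal lam x (a *\<^sub>R x + y)"
    using False by (simp only: rho_orthogonal_def rho_add_multiple) (simp add: a_def)
  then have "rho_orthogonal lam (T x) (a *\<^sub>R T x + T y)"
    using pres by (metis linear_add[OF T] linear_scale[OF T])
  then have "rho lam (T x) (T y) = - a * (norm (T x))\<^sup>2"
    by (simp add: rho_orthogonal_def rho_add_multiple)
  then show ?thesis using False by (simp add: a_def)
qed

text \<open>If \<open>T z = 0\<close> and \<open>T x \<noteq> 0\<close>, then at the point \<open>z + t x\<close> the direction \<open>x\<close> has logarithmic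
  derivative exactly \<open>1 / t\<close> in the image and at most \<open>norm x / norm (z + t x)\<close> in the domain, so
  \<open>norm (z + t x) \<le> t * norm x\<close> for all \<open>t > 0\<close>; letting \<open>t\<close> be small gives \<open>z = 0\<close>.\<close>

lemma proportional_imp_injective:
  assumes lam: "0 \<le> lam" "lam \<le> 1" and T: "linear T"
    and proportional: "\<And>x y. rho lam (T x) (T y) * (norm x)\<^sup>2 = (norm (T x))\<^sup>2 * rho lam x y"
    and nz: "T x \<noteq> 0" and z: "T z = 0"
  shows "z = 0"
proof (rule ccontr)
  assume "z \<noteq> 0"
  have x: "x \<noteq> 0" using nz linear_0[OF T] by auto
  \<comment> \<open>Then \<open>z + t x\<close> has norm at least \<open>2 t * norm x\<close>, which violates the bound \<open>t * norm x\<close>.\<close>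
  define t where "t = norm z / (3 * norm x)"
  have t: "0 < t" using \<open>z \<noteq> 0\<close> x by (simp add: t_def)
  define w where "w = z + t *\<^sub>R x"
  have Tw: "T w = t *\<^sub>R T x" by (simp add: w_def linear_add[OF T] linear_scale[OF T] z)
  have tx: "3 * (t * norm x) = norm z" using x by (simp add: t_def)
  have "norm z \<le> norm w + norm (t *\<^sub>R x)"
    using norm_triangle_ineq4[of w "t *\<^sub>R x"] by (simp add: w_def)
  then have big: "2 * (t * norm x) \<le> norm w" using t tx by simp
  then have w: "0 < norm w" using t x
    by (smt (verit) mult_pos_pos zero_less_norm_iff)
  have "t * rho lam (T w) (T x) = (norm (T w))\<^sup>2"
  proof -
    have "T x = (1 / t) *\<^sub>R T w" using t by (simp add: Tw)
    then have "rho lam (T w) (T x) = 1 / t * (norm (T w))\<^sup>2"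
      by (metis rho_multiple_self)
    then show ?thesis using t by simp
  qed
  then have "(norm (T w))\<^sup>2 * (norm w)\<^sup>2 = (norm (T w))\<^sup>2 * (t * rho lam w x)"
    using proportional[of w x] by (metis mult.assoc mult.left_commute)
  then have "(norm w)\<^sup>2 = t * rho lam w x" using t nz by (simp add: Tw)
  also have "\<dots> \<le> t * (norm w * norm x)"
    using rho_le_norm_mult[OF lam] t by (intro mult_left_mono) auto
  finally have "norm w * norm w \<le> norm w * (t * norm x)"
    by (simp add: power2_eq_square mult.left_commute)
  then have "norm w \<le> t * norm x" using w by simp
  then show False using big w by linarith
qed

text \<open>Points joined by a segment avoiding the origin are compared by the subgradient criterion; if
  the segment meets the origin, the points are proportional and homogeneity suffices.\<close>

lemma proportional_imp_ratio_eq: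
  fixes T :: "'a::real_normed_vector \<Rightarrow> 'b::real_normed_vector"
  assumes lam: "0 \<le> lam" "lam \<le> 1" and T: "bounded_linear T"
    and proportional: "\<And>x y. rho lam (T x) (T y) * (norm x)\<^sup>2 = (norm (T x))\<^sup>2 * rho lam x y"
    and inj: "\<And>z. T z = 0 \<Longrightarrow> z = 0"
    and x: "x \<noteq> 0" and y: "y \<noteq> 0"
  shows "norm (T y) / norm y = norm (T x) / norm x"
proof -
  interpret T: bounded_linear T by (rule T)
  define v where "v = y - x"
  let ?c = "\<lambda>t. x + t *\<^sub>R v"
  show ?thesis
  proof (cases "\<exists>t\<in>{0..1}. ?c t = 0")
    case True
    then obtain t where t: "0 \<le> t" "t \<le> 1" "?c t = 0" by auto
    then have eq: "t *\<^sub>R y = - ((1 - t) *\<^sub>R x)"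
      by (simp add: v_def algebra_simps)
    have n: "t * norm y = (1 - t) * norm x"
      using arg_cong[OF eq, of norm] t by simp
    have "t *\<^sub>R T y = - ((1 - t) *\<^sub>R T x)"
      using arg_cong[OF eq, of T] by (simp add: T.scaleR T.neg)
    from arg_cong[OF this, of norm] have Tn: "t * norm (T y) = (1 - t) * norm (T x)"
      using t by simp
    have t0: "t \<noteq> 0" using t x by auto
    have "t * (norm (T y) * norm x) = t * (norm (T x) * norm y)"
      using n Tn by (metis mult.assoc mult.commute)
    then show ?thesis using t0 x y by (simp add: field_simps)
  next
    case False
    then have nz: "?c t \<noteq> 0" if "t \<in> {0..1}" for t using that by auto
    define p where "p t = norm (?c t)" for t
    define q where "q t = norm (T (?c t))" for t
    define D where "D t = rho lam (?c t) v / p t" for t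
    have pos: "0 < p t" "0 < q t" if "t \<in> {0..1}" for t
      using nz[OF that] inj by (auto simp: p_def q_def)
    have "continuous_on {0..1} p" unfolding p_def by (intro continuous_intros)
    then obtain t0 where t0: "t0 \<in> {0..1}" "\<And>t. t \<in> {0..1} \<Longrightarrow> p t0 \<le> p t"
      using continuous_attains_inf[of "{0..1::real}" p] by auto
    have shift: "?c s = ?c t + (s - t) *\<^sub>R v" for s t by (simp add: algebra_simps)
    have "q 1 / p 1 = q 0 / p 0"
    proof (rule ratio_eq_of_common_log_subgradient[where m = "p t0" and K = "onorm T" and D = D])
      show "0 < p t0" using pos t0 by blast
      show "p t0 \<le> p t" if "t \<in> {0..1}" for t using t0 that by blast
      show "0 \<le> q t" for t by (simp add: q_def)
      show "q t \<le> onorm T * p t" for t unfolding p_def q_def by (rule onorm[OF T])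
    next
      fix s t :: real assume t: "t \<in> {0..1}"
      have "p s = norm (?c t + (s - t) *\<^sub>R v)"
        by (simp only: p_def shift[of s t])
      moreover have "rho lam (?c t) v = p t * D t"
        using pos(1)[OF t] by (simp add: D_def)
      ultimately have "(s - t) * (p t * D t) \<le> p t * (p s - p t)"
        using rho_subgradient[OF lam, of "s - t" "?c t" v] by (simp only: p_def[symmetric])
      then have "p t * ((s - t) * D t) \<le> p t * (p s - p t)" by (simp add: mult.left_commute)
      then show "p t + (s - t) * D t \<le> p s" using pos(1)[OF t] by simp
    next
      fix s t :: real assume t: "t \<in> {0..1}"
      have "q s = norm (T (?c t) + (s - t) *\<^sub>R T v)"
        by (simp only: q_def shift[of s t] T.add T.scaleR)
      then have "(s - t) * rho lam (T (?c t)) (T v) \<le> q t * (q s - q t)"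
        using rho_subgradient[OF lam, of "s - t" "T (?c t)" "T v"] by (simp only: q_def[symmetric])
      moreover have "rho lam (T (?c t)) (T v) = q t * (q t / p t * D t)"
        using proportional[of "?c t" v] pos(1)[OF t] unfolding p_def[symmetric] q_def[symmetric] D_def
        by (simp add: field_simps power2_eq_square)
      ultimately have "q t * ((s - t) * (q t / p t * D t)) \<le> q t * (q s - q t)"
        by (metis mult.left_commute)
      then have "(s - t) * (q t / p t * D t) \<le> q s - q t"
        using pos(2)[OF t] by (rule mult_left_le_imp_le)
      then show "q t + (s - t) * (q t / p t * D t) \<le> q s" by linarith
    qed
    then show ?thesis by (simp add: p_def q_def v_def)
  qed
qed

lemma norm_eq_onorm_mult_of_constant_ratio:
  assumes T: "bounded_linear T" and nz: "x0 \<noteq> 0"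
    and ratio: "\<And>x. x \<noteq> 0 \<Longrightarrow> norm (T x) / norm x = norm (T x0) / norm x0"
  shows "norm (T x) = onorm T * norm x"
proof -
  interpret T: bounded_linear T by (rule T)
  define c where "c = norm (T x0) / norm x0"
  have c: "norm (T x) = c * norm x" for x
    using ratio[of x] by (cases "x = 0") (auto simp: c_def T.zero divide_eq_eq)
  have "onorm T \<le> c"
    by (rule onorm_bound) (auto simp: c, simp add: c_def)
  moreover have "c \<le> onorm T"
    using onorm[OF T, of x0] nz by (simp add: c)
  ultimately show ?thesis using c by simp
qed

theorem theorem3p4:
  fixes T :: "'a::real_normed_vector \<Rightarrow> 'b::real_normed_vector" and lam :: real
  assumes dimX: "\<exists>B :: 'a set. independent B \<and> card B = 2"
    and dimY: "\<exists>B :: 'b set. independent B \<and> card B = 2"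
    and lam: "0 \<le> lam" "lam \<le> 1"
    and T: "bounded_linear T"
    and nonzero: "\<exists>x. T x \<noteq> 0"
  shows "((\<forall>x y. rho_orthogonal lam x y \<longrightarrow> rho_orthogonal lam (T x) (T y))
            \<longleftrightarrow> (\<forall>x. norm (T x) = onorm T * norm x))
       \<and> ((\<forall>x. norm (T x) = onorm T * norm x)
            \<longleftrightarrow> (\<forall>x y. rho lam (T x) (T y) = (onorm T)\<^sup>2 * rho lam x y))"
    (is "(?i \<longleftrightarrow> ?ii) \<and> (?ii \<longleftrightarrow> ?iii)")
proof -
  have lin: "linear T" using T by (rule bounded_linear.linear)
  obtain x0 where x0: "T x0 \<noteq> 0" using nonzero by blast
  have x0_nz: "x0 \<noteq> 0" using x0 linear_0[OF lin] by auto
  have "?ii" if ?i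
  proof -
    have proportional: "rho lam (T x) (T y) * (norm x)\<^sup>2 = (norm (T x))\<^sup>2 * rho lam x y" for x y
      using that by (intro preserves_imp_proportional[OF lin]) blast
    have inj: "z = 0" if "T z = 0" for z
      using proportional_imp_injective[OF lam lin proportional x0 that] .
    have "norm (T x) / norm x = norm (T x0) / norm x0" if "x \<noteq> 0" for x
      using proportional_imp_ratio_eq[OF lam T proportional inj x0_nz that] .
    then show ?ii using norm_eq_onorm_mult_of_constant_ratio[OF T x0_nz] by blast
  qed
  moreover have "?iii" if ?ii
    using rho_scaled_isometry[OF lin] that by blast
  moreover have "?i" if ?iii
    using that by (simp add: rho_orthogonal_def)
  moreover have "?ii" if ?iii
  proof
    fix x
    have "(norm (T x))\<^sup>2 = (onorm T * norm x)\<^sup>2"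
      using that rho_self[of lam x] rho_self[of lam "T x"] by (metis power_mult_distrib)
    then show "norm (T x) = onorm T * norm x"
      by (rule power2_eq_imp_eq) (auto intro!: mult_nonneg_nonneg onorm_pos_le[OF T])
  qed
  ultimately show ?thesis by blast
qed

end
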